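(* Let $A\in\mathbb{R}^{n\times n}$. Any one of the following three conditions implies that $A$ is an EP-matrix: 1) $A$ is lower triangular or upper triangular. 2) $A$ is symmetric. 3) $A$ is Jacobi.
   Context: A matrix in $\mathbb{R}^{n\times n}$ is called a P-matrix if all its principal minors are positive. A matrix $A\in\mathbb{R}^{n\times n}$ is called an EP-matrix (exponential P-matrix) if $\exp(At)$ is a P-matrix for all $t\ge 0$. A matrix is called Jacobi if it is tri-diagonal with positive entries on the super-diagonal and on the sub-diagonal (the main diagonal entries are arbitrary real numbers). *)

theory Defs
  imports
    Complex_Main
    "Jordan_Normal_Form.Determinant"
    "Jordan_Normal_Form.DL_Submatrix"
    "Jordan_Normal_Form.Jordan_Normal_Form"
begin

definition exp_mat :: "real mat \<Rightarrow> real mat" where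
  "exp_mat A = mat (dim_row A) (dim_col A) (\<lambda>(i, j). \<Sum>k. (A ^\<^sub>m k) $$ (i, j) / fact k)"

text \<open>The entrywise series in \<^const>\<open>exp_mat\<close> converges for every square matrix.\<close>

lemma exp_mat_index_sums:
  assumes A: "A \<in> carrier_mat n n" and i: "i < n" and j: "j < n"
  shows "(\<lambda>k. (A ^\<^sub>m k) $$ (i, j) / fact k) sums (exp_mat A $$ (i, j))"
proof -
  obtain b where b: "norm_bound A b"
    using norm_bound_max by blast
  define c where "c = max 1 (\<bar>b\<bar> * real n)"
  have bnd: "norm_bound (A ^\<^sub>m k) (c ^ k)" for k
  proof (induction k)
    case 0
    show ?case by (auto simp: norm_bound_def)
  next
    case (Suc k)
    have "norm_bound (A ^\<^sub>m k * A) (c ^ k * b * of_nat n)"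
      using norm_bound_mult[OF pow_carrier_mat[OF A] A Suc b] .
    moreover have "c ^ k * b * of_nat n \<le> c ^ Suc k"
    proof -
      have "b * real n \<le> \<bar>b\<bar> * real n"
        by (intro mult_right_mono) auto
      hence "b * real n \<le> c"
        by (auto simp: c_def)
      moreover have "0 \<le> c ^ k"
        by (simp add: c_def)
      ultimately have "c ^ k * (b * real n) \<le> c ^ k * c"
        by (rule mult_left_mono)
      thus ?thesis by (simp add: mult_ac)
    qed
    ultimately show ?case
      by (fastforce simp: norm_bound_def intro: order_trans)
  qed
  have le: "norm ((A ^\<^sub>m k) $$ (i, j) / fact k) \<le> c ^ k /\<^sub>R fact k" for k
  proof -
    have "norm ((A ^\<^sub>m k) $$ (i, j)) \<le> c ^ k"
      using bnd[of k] A i j by (auto simp: norm_bound_def split: if_splits)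
    thus ?thesis
      by (simp add: field_simps)
  qed
  have "summable (\<lambda>k. (A ^\<^sub>m k) $$ (i, j) / fact k)"
    by (rule summable_comparison_test'[OF summable_exp_generic[of c]]) (use le in auto)
  thus ?thesis
    using A i j by (simp add: exp_mat_def summable_sums)
qed

text \<open>Principal minors are indexed by the nonempty sets of row and column indices.\<close>

definition P_matrix :: "real mat \<Rightarrow> bool" where
  "P_matrix A \<longleftrightarrow> square_mat A \<and>
     (\<forall>I \<subseteq> {0..<dim_row A}. I \<noteq> {} \<longrightarrow> det (submatrix A I I) > 0)"

definition EP_matrix :: "real mat \<Rightarrow> bool" where
  "EP_matrix A \<longleftrightarrow> square_mat A \<and> (\<forall>t \<ge> 0. P_matrix (exp_mat (t \<cdot>\<^sub>m A)))"

definition lower_triangular :: "'a::zero mat \<Rightarrow> bool" where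
  "lower_triangular A \<longleftrightarrow> (\<forall>i < dim_row A. \<forall>j < dim_col A. i < j \<longrightarrow> A $$ (i, j) = 0)"

definition symmetric_matrix :: "'a mat \<Rightarrow> bool" where
  "symmetric_matrix A \<longleftrightarrow> transpose_mat A = A"

definition tridiagonal :: "'a::zero mat \<Rightarrow> bool" where
  "tridiagonal A \<longleftrightarrow>
     (\<forall>i < dim_row A. \<forall>j < dim_col A. Suc i < j \<or> Suc j < i \<longrightarrow> A $$ (i, j) = 0)"

definition Jacobi_matrix :: "real mat \<Rightarrow> bool" where
  "Jacobi_matrix A \<longleftrightarrow> square_mat A \<and> tridiagonal A \<and>
     (\<forall>i. Suc i < dim_row A \<longrightarrow> A $$ (i, Suc i) > 0 \<and> A $$ (Suc i, i) > 0)"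

end

theory Submission
  imports Defs
begin

text \<open>
  For triangular \<open>A\<close> the exponential is triangular with diagonal entries \<open>exp (t a\<^sub>i\<^sub>i)\<close>. In the other
  two cases there are positive weights \<open>d\<close> with \<open>d\<^sub>i a\<^sub>i\<^sub>j = d\<^sub>j a\<^sub>j\<^sub>i\<close>, that is, \<open>A\<close> is self-adjoint for
  the inner product \<open>\<Sum>\<^sub>i d\<^sub>i x\<^sub>i y\<^sub>i\<close>. Then so is \<open>exp (t A) = (exp (t/2 A))\<^sup>2\<close>, which is therefore
  positive definite for this inner product, and no principal minor of \<open>exp (t A)\<close> vanishes. These
  minors depend continuously on \<open>t\<close> and equal 1 at \<open>t = 0\<close>, so they stay positive.
\<close>

section \<open>The exponential of a matrix\<close>

lemma pow_mat_add:
  fixes A :: "'a::semiring_1 mat"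
  assumes A: "A \<in> carrier_mat n n"
  shows "A ^\<^sub>m (j + k) = A ^\<^sub>m j * A ^\<^sub>m k"
proof (induction k)
  case 0
  show ?case using A by (simp add: right_mult_one_mat[OF pow_carrier_mat[OF A]])
next
  case (Suc k)
  show ?case
    using Suc assoc_mult_mat[OF pow_carrier_mat[OF A] pow_carrier_mat[OF A] A, of j k] by simp
qed

lemma pow_mat_Suc_left:
  fixes A :: "'a::semiring_1 mat"
  assumes A: "A \<in> carrier_mat n n"
  shows "A ^\<^sub>m Suc k = A * A ^\<^sub>m k"
  using pow_mat_add[OF A, of 1 k] A by simp

lemma smult_pow_mat:
  fixes A :: "'a::comm_semiring_1 mat"
  assumes A: "A \<in> carrier_mat n n"
  shows "(c \<cdot>\<^sub>m A) ^\<^sub>m k = c ^ k \<cdot>\<^sub>m A ^\<^sub>m k"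
proof (induction k)
  case 0
  show ?case using A by auto
next
  case (Suc k)
  have Ak: "A ^\<^sub>m k \<in> carrier_mat n n" using A by simp
  have "(c \<cdot>\<^sub>m A) ^\<^sub>m Suc k = (c ^ k \<cdot>\<^sub>m A ^\<^sub>m k) * (c \<cdot>\<^sub>m A)" by (simp add: Suc)
  also have "\<dots> = c ^ k \<cdot>\<^sub>m (c \<cdot>\<^sub>m (A ^\<^sub>m k * A))"
    using mult_smult_assoc_mat[OF Ak smult_carrier_mat[OF A, of c], of "c ^ k"]
      mult_smult_distrib[OF Ak A, of c] by (simp only:)
  also have "\<dots> = c ^ Suc k \<cdot>\<^sub>m A ^\<^sub>m Suc k"
    by (intro eq_matI) (auto simp: mult_ac)
  finally show ?case .
qed

lemma transpose_pow_mat: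
  fixes A :: "'a::comm_semiring_1 mat"
  assumes A: "A \<in> carrier_mat n n"
  shows "(transpose_mat A) ^\<^sub>m k = transpose_mat (A ^\<^sub>m k)"
proof (induction k)
  case 0
  show ?case using A by simp
next
  case (Suc k)
  show ?case
    unfolding pow_mat_Suc_left[OF A] transpose_mult[OF A pow_carrier_mat[OF A]] by (simp add: Suc)
qed

lemma index_mult_mat_sum:
  assumes "A \<in> carrier_mat n m" "B \<in> carrier_mat m p" "i < n" "j < p"
  shows "(A * B) $$ (i, j) = (\<Sum>l<m. A $$ (i, l) * B $$ (l, j))"
  using assms by (auto simp: scalar_prod_def atLeast0LessThan intro!: sum.cong)

section \<open>Entries of \<open>exp (t A)\<close> as power series in \<open>t\<close>\<close>

lemma exp_mat_carrier [simp]: "A \<in> carrier_mat n n \<Longrightarrow> exp_mat A \<in> carrier_mat n n"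
  by (auto simp: exp_mat_def)

lemma exp_mat_smult_sums:
  assumes A: "A \<in> carrier_mat n n" and i: "i < n" and j: "j < n"
  shows "(\<lambda>k. (A ^\<^sub>m k) $$ (i, j) / fact k * t ^ k) sums (exp_mat (t \<cdot>\<^sub>m A) $$ (i, j))"
proof -
  have "(\<lambda>k. ((t \<cdot>\<^sub>m A) ^\<^sub>m k) $$ (i, j) / fact k) sums (exp_mat (t \<cdot>\<^sub>m A) $$ (i, j))"
    by (rule exp_mat_index_sums) (use A i j in auto)
  moreover have "((t \<cdot>\<^sub>m A) ^\<^sub>m k) $$ (i, j) / fact k = (A ^\<^sub>m k) $$ (i, j) / fact k * t ^ k" for k
    unfolding smult_pow_mat[OF A] using A i j by simp
  ultimately show ?thesis by simp
qed

text \<open>Absolute convergence is what the Cauchy product in the addition law asks for. The power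
  series converges at \<open>\<bar>t\<bar> + 1\<close>, hence absolutely at the strictly smaller
  modulus of \<open>t\<close>.\<close>

lemma exp_mat_smult_summable_norm:
  fixes t :: real
  assumes "A \<in> carrier_mat n n" "i < n" "j < n"
  shows "summable (\<lambda>k. norm ((A ^\<^sub>m k) $$ (i, j) / fact k * t ^ k))"
proof (rule powser_insidea[of _ "\<bar>t\<bar> + 1"])
  show "summable (\<lambda>k. (A ^\<^sub>m k) $$ (i, j) / fact k * (\<bar>t\<bar> + 1) ^ k)"
    using exp_mat_smult_sums[OF assms] by (rule sums_summable)
qed auto

lemma isCont_exp_mat_smult:
  assumes A: "A \<in> carrier_mat n n" and i: "i < n" and j: "j < n"
  shows "isCont (\<lambda>t. exp_mat (t \<cdot>\<^sub>m A) $$ (i, j)) t"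
proof -
  have "exp_mat (t \<cdot>\<^sub>m A) $$ (i, j) = (\<Sum>k. (A ^\<^sub>m k) $$ (i, j) / fact k * t ^ k)" for t
    using exp_mat_smult_sums[OF assms] by (rule sums_unique)
  thus ?thesis
    using isCont_powser_converges_everywhere[of "\<lambda>k. (A ^\<^sub>m k) $$ (i, j) / fact k" t]
      exp_mat_smult_sums[OF assms] by (simp add: sums_iff)
qed

lemma exp_mat_smult_zero:
  assumes A: "A \<in> carrier_mat n n"
  shows "exp_mat (0 \<cdot>\<^sub>m A) = 1\<^sub>m n"
proof (rule eq_matI)
  fix i j assume "i < dim_row (1\<^sub>m n :: real mat)" "j < dim_col (1\<^sub>m n :: real mat)"
  hence ij: "i < n" "j < n" by auto
  have "exp_mat (0 \<cdot>\<^sub>m A) $$ (i, j) = (\<Sum>k. (A ^\<^sub>m k) $$ (i, j) / fact k * 0 ^ k)"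
    using exp_mat_smult_sums[OF A ij] by (rule sums_unique)
  also have "\<dots> = (A ^\<^sub>m 0) $$ (i, j) / fact 0"
    by (rule powser_zero)
  finally show "exp_mat (0 \<cdot>\<^sub>m A) $$ (i, j) = 1\<^sub>m n $$ (i, j)"
    using A by simp
qed (use A in \<open>auto simp: exp_mat_def\<close>)

text \<open>Both exponentials are series in powers of the same matrix, so the scalar proof carries
  over entrywise: multiply the series by the Cauchy product and apply the binomial theorem. Two
  instances are used later: \<open>s = t\<close> for a square root of the exponential, and
  \<open>s = -t\<close> for its inverse.\<close>

lemma exp_mat_smult_add:
  assumes A: "A \<in> carrier_mat n n"
  shows "exp_mat ((s + t) \<cdot>\<^sub>m A) = exp_mat (s \<cdot>\<^sub>m A) * exp_mat (t \<cdot>\<^sub>m A)"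
proof (rule eq_matI)
  fix i j
  assume "i < dim_row (exp_mat (s \<cdot>\<^sub>m A) * exp_mat (t \<cdot>\<^sub>m A))"
    "j < dim_col (exp_mat (s \<cdot>\<^sub>m A) * exp_mat (t \<cdot>\<^sub>m A))"
  hence i: "i < n" and j: "j < n" using A by (auto simp: exp_mat_def)
  define a where "a k p q = (A ^\<^sub>m k) $$ (p, q) / fact k" for k p q
  have "(\<lambda>k. \<Sum>m\<le>k. (a m i l * s ^ m) * (a (k - m) l j * t ^ (k - m))) sums
      (exp_mat (s \<cdot>\<^sub>m A) $$ (i, l) * exp_mat (t \<cdot>\<^sub>m A) $$ (l, j))" if l: "l < n" for l
    using Cauchy_product_sums[OF exp_mat_smult_summable_norm[OF A i l, of s]
        exp_mat_smult_summable_norm[OF A l j, of t]]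
      exp_mat_smult_sums[OF A i l, of s] exp_mat_smult_sums[OF A l j, of t]
    by (simp add: sums_iff a_def)
  hence "(\<lambda>k. \<Sum>l<n. \<Sum>m\<le>k. (a m i l * s ^ m) * (a (k - m) l j * t ^ (k - m))) sums
      (\<Sum>l<n. exp_mat (s \<cdot>\<^sub>m A) $$ (i, l) * exp_mat (t \<cdot>\<^sub>m A) $$ (l, j))"
    by (intro sums_sum) auto
  also have "(\<lambda>k. \<Sum>l<n. \<Sum>m\<le>k. (a m i l * s ^ m) * (a (k - m) l j * t ^ (k - m))) =
      (\<lambda>k. a k i j * (s + t) ^ k)"
  proof
    fix k
    \<comment> \<open>The matrix part of a Cauchy term depends on \<open>k\<close> only, not on how
      \<open>k\<close> splits into \<open>m\<close> and \<open>k - m\<close>. It therefore factors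
      out and leaves the binomial expansion of \<open>(s + t) ^ k\<close>.\<close>
    have *: "(\<Sum>l<n. (A ^\<^sub>m m) $$ (i, l) * (A ^\<^sub>m (k - m)) $$ (l, j)) = (A ^\<^sub>m k) $$ (i, j)"
      if "m \<le> k" for m
      using pow_mat_add[OF A, of m "k - m"] that i j
        index_mult_mat_sum[OF pow_carrier_mat[OF A] pow_carrier_mat[OF A], of i j m "k - m"] by simp
    have "(\<Sum>l<n. \<Sum>m\<le>k. (a m i l * s ^ m) * (a (k - m) l j * t ^ (k - m))) =
        (\<Sum>m\<le>k. \<Sum>l<n. (a m i l * s ^ m) * (a (k - m) l j * t ^ (k - m)))"
      by (rule sum.swap)
    also have "\<dots> = (\<Sum>m\<le>k. s ^ m * t ^ (k - m) / (fact m * fact (k - m)) *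
        (\<Sum>l<n. (A ^\<^sub>m m) $$ (i, l) * (A ^\<^sub>m (k - m)) $$ (l, j)))"
      by (simp add: sum_distrib_left a_def mult_ac)
    also have "\<dots> = (\<Sum>m\<le>k. a k i j * (of_nat (k choose m) * s ^ m * t ^ (k - m)))"
      by (intro sum.cong) (simp_all add: * a_def binomial_fact)
    also have "\<dots> = a k i j * (s + t) ^ k"
      by (simp add: binomial_ring sum_distrib_left)
    finally show "(\<Sum>l<n. \<Sum>m\<le>k. (a m i l * s ^ m) * (a (k - m) l j * t ^ (k - m))) =
        a k i j * (s + t) ^ k" .
  qed
  finally have "(\<Sum>l<n. exp_mat (s \<cdot>\<^sub>m A) $$ (i, l) * exp_mat (t \<cdot>\<^sub>m A) $$ (l, j)) =
      exp_mat ((s + t) \<cdot>\<^sub>m A) $$ (i, j)"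
    using exp_mat_smult_sums[OF A i j, of "s + t"] unfolding a_def by (rule sums_unique2)
  thus "exp_mat ((s + t) \<cdot>\<^sub>m A) $$ (i, j) = (exp_mat (s \<cdot>\<^sub>m A) * exp_mat (t \<cdot>\<^sub>m A)) $$ (i, j)"
    using A i j by (subst index_mult_mat_sum[of _ n n _ n]) auto
qed (use A in \<open>auto simp: exp_mat_def\<close>)

lemma exp_mat_transpose:
  assumes A: "A \<in> carrier_mat n n"
  shows "exp_mat (transpose_mat A) = transpose_mat (exp_mat A)"
  unfolding exp_mat_def transpose_pow_mat[OF A]
  by (rule eq_matI) (use A in auto)


section \<open>Principal submatrices\<close>

lemma principal_submatrix_carrier:
  assumes "A \<in> carrier_mat n n" "I \<subseteq> {0..<n}"
  shows "submatrix A I I \<in> carrier_mat (card I) (card I)"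
proof -
  have "{i. i < n \<and> i \<in> I} = I" using assms(2) by auto
  moreover have "dim_row A = n" "dim_col A = n" using assms(1) by auto
  ultimately show ?thesis by (intro carrier_matI) (simp_all only: dim_submatrix)
qed

lemma principal_submatrix_index:
  assumes "A \<in> carrier_mat n n" "I \<subseteq> {0..<n}" "a < card I" "b < card I"
  shows "submatrix A I I $$ (a, b) = A $$ (pick I a, pick I b)"
proof -
  have "{i. i < n \<and> i \<in> I} = I" using assms(2) by auto
  moreover have "dim_row A = n" "dim_col A = n" using assms(1) by auto
  ultimately show ?thesis using assms(3,4) by (intro submatrix_index) simp_all
qed

lemma pick_less:
  assumes "I \<subseteq> {0..<n}" "a < card I"
  shows "pick I a < n"
  using pick_in_set_le[OF assms(2)] assms(1) by auto

text \<open>\<open>pick I\<close> is strictly increasing, hence injective, and counting makes it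
  onto. This turns sums over \<open>I\<close> into sums over the row indices of a submatrix.\<close>

lemma bij_betw_pick:
  assumes "finite I"
  shows "bij_betw (pick I) {..<card I} I"
proof -
  have inj: "inj_on (pick I) {..<card I}"
    by (rule linorder_inj_onI') (use pick_mono_le in \<open>force simp: less_imp_neq\<close>)
  moreover have "pick I ` {..<card I} \<subseteq> I"
    using pick_in_set_le by auto
  ultimately show ?thesis
    using assms card_image[OF inj] card_subset_eq[of I "pick I ` {..<card I}"]
    by (auto simp: bij_betw_def)
qed

text \<open>A principal submatrix uses the same index set for rows and columns, so it commutes with
  transposition, which preserves determinants.\<close>

lemma P_matrix_transpose:
  assumes A: "A \<in> carrier_mat n n" and P: "P_matrix A"
  shows "P_matrix (transpose_mat A)"
proof -
  have "det (submatrix (transpose_mat A) I I) > 0" if I: "I \<subseteq> {0..<n}" "I \<noteq> {}" for I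
  proof -
    have "submatrix (transpose_mat A) I I = transpose_mat (submatrix A I I)"
      using A I by (intro eq_matI)
        (auto simp: submatrix_def pick_less dim_submatrix intro!: index_transpose_mat pick_le)
    moreover have "det (submatrix A I I) > 0"
      using P I A by (auto simp: P_matrix_def)
    ultimately show ?thesis
      using det_transpose[OF principal_submatrix_carrier[OF A I(1)]] by simp
  qed
  thus ?thesis using A by (auto simp: P_matrix_def)
qed

text \<open>Since \<open>pick I\<close> is increasing, principal submatrices stay upper triangular,
  and their diagonals are parts of the diagonal of \<open>A\<close>. Each principal minor is thus a
  product of positive numbers.\<close>

lemma upper_triangular_P_matrix:
  assumes A: "A \<in> carrier_mat n n" and U: "upper_triangular A"
    and pos: "\<And>i. i < n \<Longrightarrow> A $$ (i, i) > 0"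
  shows "P_matrix A"
proof -
  have "det (submatrix A I I) > 0" if I: "I \<subseteq> {0..<n}" for I
  proof -
    note S = principal_submatrix_carrier[OF A I]
    have "upper_triangular (submatrix A I I)"
    proof
      fix a b assume *: "b < a" "a < dim_row (submatrix A I I)"
      hence "a < card I" using S by simp
      thus "submatrix A I I $$ (a, b) = 0"
        using * A U pick_mono_le[of a I b] pick_less[OF I, of a]
        by (simp add: principal_submatrix_index[OF A I] upper_triangular_def)
    qed
    hence "det (submatrix A I I) = (\<Prod>a = 0..<card I. submatrix A I I $$ (a, a))"
      using S by (simp add: det_upper_triangular prod_list_diag_prod)
    also have "\<dots> > 0"
      by (intro prod_pos) (auto simp: principal_submatrix_index[OF A I] pos pick_less[OF I])
    finally show ?thesis .
  qed
  thus ?thesis using A by (auto simp: P_matrix_def)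
qed


section \<open>Triangular matrices\<close>

text \<open>In row \<open>i\<close> times column \<open>j\<close> only \<open>l = i\<close>
  survives: for \<open>l < i\<close> the entry of the power lies below the diagonal, and for
  \<open>l > i\<close> the entry of \<open>A\<close> does, because \<open>j \<le> i\<close>.\<close>

lemma upper_triangular_pow_mat:
  fixes A :: "'a::comm_semiring_1 mat"
  assumes A: "A \<in> carrier_mat n n" and U: "upper_triangular A" and ij: "j \<le> i" "i < n"
  shows "(A ^\<^sub>m k) $$ (i, j) = (if i = j then (A $$ (i, i)) ^ k else 0)"
  using ij
proof (induction k arbitrary: i j)
  case 0
  thus ?case using A by auto
next
  case (Suc k)
  have "(A ^\<^sub>m Suc k) $$ (i, j) = (\<Sum>l<n. (A ^\<^sub>m k) $$ (i, l) * A $$ (l, j))"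
    using index_mult_mat_sum[OF pow_carrier_mat[OF A] A, of i j k] Suc.prems by simp
  also have "\<dots> = (\<Sum>l<n. if l = i then (A $$ (i, i)) ^ k * A $$ (i, j) else 0)"
  proof (rule sum.cong)
    fix l assume "l \<in> {..<n}"
    moreover have "A $$ (l, j) = 0" if "i < l" "l < n"
      using U A Suc.prems that by (auto simp: upper_triangular_def)
    ultimately show "(A ^\<^sub>m k) $$ (i, l) * A $$ (l, j) =
        (if l = i then (A $$ (i, i)) ^ k * A $$ (i, j) else 0)"
      using Suc.IH[of l i] Suc.prems by (cases "i < l") auto
  qed simp
  also have "\<dots> = (if i = j then (A $$ (i, i)) ^ Suc k else 0)"
    using U A Suc.prems by (auto simp: upper_triangular_def mult_ac)
  finally show ?case .
qed

text \<open>Below the diagonal the series has only zero terms; on the diagonal it is the scalar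
  exponential series of the diagonal entry.\<close>

lemma upper_triangular_P_matrix_exp:
  assumes A: "A \<in> carrier_mat n n" and U: "upper_triangular A"
  shows "P_matrix (exp_mat A)"
proof (rule upper_triangular_P_matrix)
  show "exp_mat A \<in> carrier_mat n n" using A by simp
  show "upper_triangular (exp_mat A)"
  proof
    fix i j assume "j < i" "i < dim_row (exp_mat A)"
    moreover have "dim_row (exp_mat A) = n" using A by (simp add: exp_mat_def)
    ultimately have ij: "j < i" "i < n" "j < n" by auto
    have "(\<lambda>k. 0) sums (exp_mat A $$ (i, j))"
      using exp_mat_index_sums[OF A ij(2,3)] ij by (simp add: upper_triangular_pow_mat[OF A U])
    thus "exp_mat A $$ (i, j) = 0" by (simp add: sums_iff)
  qed
  show "exp_mat A $$ (i, i) > 0" if i: "i < n" for i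
  proof -
    have "(\<lambda>k. (A $$ (i, i)) ^ k / fact k) sums (exp_mat A $$ (i, i))"
      using exp_mat_index_sums[OF A i i] i by (simp add: upper_triangular_pow_mat[OF A U])
    moreover have "(\<lambda>k. (A $$ (i, i)) ^ k / fact k) sums exp (A $$ (i, i))"
      using exp_converges[of "A $$ (i, i)"] by (simp add: field_simps)
    ultimately have "exp_mat A $$ (i, i) = exp (A $$ (i, i))" by (rule sums_unique2)
    thus ?thesis by simp
  qed
qed

lemma upper_triangular_EP_matrix:
  assumes A: "A \<in> carrier_mat n n" and U: "upper_triangular A"
  shows "EP_matrix A"
proof -
  have "P_matrix (exp_mat (t \<cdot>\<^sub>m A))" for t
    by (rule upper_triangular_P_matrix_exp[of _ n])
      (use A U in \<open>auto simp: upper_triangular_def\<close>)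
  thus ?thesis using A by (simp add: EP_matrix_def)
qed

text \<open>This reduces lower triangular matrices to upper triangular ones.\<close>

lemma EP_matrix_transpose:
  assumes A: "A \<in> carrier_mat n n" and EP: "EP_matrix A"
  shows "EP_matrix (transpose_mat A)"
proof -
  have "P_matrix (exp_mat (t \<cdot>\<^sub>m transpose_mat A))" if "t \<ge> 0" for t
  proof -
    have "t \<cdot>\<^sub>m transpose_mat A = transpose_mat (t \<cdot>\<^sub>m A)"
      by (rule eq_matI) auto
    hence "exp_mat (t \<cdot>\<^sub>m transpose_mat A) = transpose_mat (exp_mat (t \<cdot>\<^sub>m A))"
      using A by (simp add: exp_mat_transpose[of _ n])
    thus ?thesis
      using EP that A by (auto simp: EP_matrix_def intro!: P_matrix_transpose[of _ n])
  qed
  thus ?thesis using A by (simp add: EP_matrix_def)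
qed


section \<open>Symmetrizable matrices\<close>

lemma symmetrizable_pow_mat:
  fixes A :: "'a::comm_semiring_1 mat"
  assumes A: "A \<in> carrier_mat n n"
    and sym: "\<And>i j. i < n \<Longrightarrow> j < n \<Longrightarrow> d i * A $$ (i, j) = d j * A $$ (j, i)"
    and ij: "i < n" "j < n"
  shows "d i * (A ^\<^sub>m k) $$ (i, j) = d j * (A ^\<^sub>m k) $$ (j, i)"
  using ij
proof (induction k arbitrary: i j)
  case 0
  thus ?case using A by auto
next
  case (Suc k)
  have "d i * (A ^\<^sub>m Suc k) $$ (i, j) = (\<Sum>l<n. (d i * (A ^\<^sub>m k) $$ (i, l)) * A $$ (l, j))"
    using index_mult_mat_sum[OF pow_carrier_mat[OF A] A, of i j k] Suc.prems
    by (simp add: sum_distrib_left mult.assoc)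
  \<comment> \<open>The weight travels from \<open>i\<close> to \<open>l\<close> by the induction
    hypothesis, then from \<open>l\<close> to \<open>j\<close> by \<open>sym\<close>. The factors
    come out in reversed order, so the last step reads the result as \<open>A\<close> times the
    power.\<close>
  also have "\<dots> = (\<Sum>l<n. (d l * A $$ (l, j)) * (A ^\<^sub>m k) $$ (l, i))"
    using Suc by (intro sum.cong) (auto simp: mult_ac)
  also have "\<dots> = (\<Sum>l<n. (d j * A $$ (j, l)) * (A ^\<^sub>m k) $$ (l, i))"
    using sym Suc.prems by (intro sum.cong) auto
  also have "\<dots> = d j * (A ^\<^sub>m Suc k) $$ (j, i)"
    unfolding pow_mat_Suc_left[OF A]
    using index_mult_mat_sum[OF A pow_carrier_mat[OF A], of j i k] Suc.prems
    by (simp add: sum_distrib_left mult.assoc)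
  finally show ?case .
qed

lemma symmetrizable_exp_mat:
  assumes A: "A \<in> carrier_mat n n"
    and sym: "\<And>i j. i < n \<Longrightarrow> j < n \<Longrightarrow> d i * A $$ (i, j) = d j * A $$ (j, i)"
    and i: "i < n" and j: "j < n"
  shows "d i * exp_mat A $$ (i, j) = d j * exp_mat A $$ (j, i)"
proof -
  have "d i * (A ^\<^sub>m k) $$ (i, j) = d j * (A ^\<^sub>m k) $$ (j, i)" for k
    by (rule symmetrizable_pow_mat[OF A sym i j])
  hence "(\<lambda>k. d i * ((A ^\<^sub>m k) $$ (i, j) / fact k)) = (\<lambda>k. d j * ((A ^\<^sub>m k) $$ (j, i) / fact k))"
    by (simp add: fun_eq_iff)
  thus ?thesis
    using sums_mult[OF exp_mat_index_sums[OF A i j], of "d i"]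
      sums_mult[OF exp_mat_index_sums[OF A j i], of "d j"] sums_unique2 by metis
qed

text \<open>With \<open>E = exp (t/2 A)\<close> self-adjoint for the weights \<open>d\<close>, the
  form at \<open>x\<close> is the weighted square norm of \<open>y = E x\<close>. Since
  \<open>E\<close> is invertible, \<open>y\<close> is nonzero whenever \<open>x\<close> is.\<close>

lemma symmetrizable_exp_mat_pos_def:
  assumes A: "A \<in> carrier_mat n n"
    and sym: "\<And>i j. i < n \<Longrightarrow> j < n \<Longrightarrow> d i * A $$ (i, j) = d j * A $$ (j, i)"
    and d: "\<And>i. i < n \<Longrightarrow> d i > 0"
    and x: "i < n" "x i \<noteq> 0"
  shows "(\<Sum>i<n. \<Sum>j<n. d i * x i * exp_mat (t \<cdot>\<^sub>m A) $$ (i, j) * x j) > 0"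
proof -
  define E where "E = exp_mat ((t / 2) \<cdot>\<^sub>m A)"
  have E: "E \<in> carrier_mat n n" using A by (simp add: E_def)
  define y where "y k = (\<Sum>j<n. E $$ (k, j) * x j)" for k
  have symE: "d i * E $$ (i, j) = d j * E $$ (j, i)" if "i < n" "j < n" for i j
    unfolding E_def using A sym that
    by (intro symmetrizable_exp_mat[of _ n]) (auto simp: mult.left_commute)
  have EE: "exp_mat (t \<cdot>\<^sub>m A) $$ (i, j) = (\<Sum>k<n. E $$ (i, k) * E $$ (k, j))"
    if "i < n" "j < n" for i j
    using exp_mat_smult_add[OF A, of "t / 2" "t / 2"] index_mult_mat_sum[OF E E that]
    by (simp add: E_def)
  have "(\<Sum>i<n. \<Sum>j<n. d i * x i * exp_mat (t \<cdot>\<^sub>m A) $$ (i, j) * x j) =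
      (\<Sum>i<n. \<Sum>j<n. \<Sum>k<n. (d i * E $$ (i, k)) * x i * (E $$ (k, j) * x j))"
    by (intro sum.cong) (auto simp: EE sum_distrib_left sum_distrib_right mult_ac)
  \<comment> \<open>Self-adjointness moves the weight to the summation index \<open>k\<close> and
    transposes the first factor, so that both factors become terms of \<open>y k\<close>.\<close>
  also have "\<dots> = (\<Sum>i<n. \<Sum>j<n. \<Sum>k<n. d k * (E $$ (k, i) * x i) * (E $$ (k, j) * x j))"
    using symE by (intro sum.cong) auto
  also have "\<dots> = (\<Sum>i<n. \<Sum>k<n. \<Sum>j<n. d k * (E $$ (k, i) * x i) * (E $$ (k, j) * x j))"
    by (intro sum.cong refl sum.swap)
  also have "\<dots> = (\<Sum>k<n. \<Sum>i<n. \<Sum>j<n. d k * (E $$ (k, i) * x i) * (E $$ (k, j) * x j))"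
    by (rule sum.swap)
  also have "\<dots> = (\<Sum>k<n. d k * (y k * y k))"
    by (intro sum.cong refl, unfold y_def sum_product) (simp add: sum_distrib_left mult_ac)
  also have "\<dots> > 0"
  proof -
    have "\<exists>k<n. y k \<noteq> 0"
    proof (rule ccontr)
      assume "\<not> (\<exists>k<n. y k \<noteq> 0)"
      hence y0: "y k = 0" if "k < n" for k using that by blast
      \<comment> \<open>\<open>F\<close> is the inverse of \<open>E\<close> by the addition law;
        applying it to \<open>y = 0\<close> gives back \<open>x = 0\<close>.\<close>
      define F where "F = exp_mat ((- (t / 2)) \<cdot>\<^sub>m A)"
      have F: "F \<in> carrier_mat n n" using A by (simp add: F_def)
      have FE: "F * E = 1\<^sub>m n"
        using exp_mat_smult_add[OF A, of "- (t / 2)" "t / 2"] exp_mat_smult_zero[OF A]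
        by (simp add: E_def F_def)
      have "0 = (\<Sum>k<n. F $$ (i, k) * y k)"
        using y0 by simp
      also have "\<dots> = (\<Sum>k<n. \<Sum>j<n. F $$ (i, k) * E $$ (k, j) * x j)"
        by (simp add: y_def sum_distrib_left mult_ac)
      also have "\<dots> = (\<Sum>j<n. \<Sum>k<n. F $$ (i, k) * E $$ (k, j) * x j)"
        by (rule sum.swap)
      also have "\<dots> = (\<Sum>j<n. (F * E) $$ (i, j) * x j)"
        by (intro sum.cong refl)
          (simp add: index_mult_mat_sum[OF F E x(1)] sum_distrib_right)
      also have "\<dots> = (\<Sum>j<n. if j = i then x j else 0)"
        using x(1) by (intro sum.cong refl) (auto simp: FE)
      also have "\<dots> = x i" using x(1) by simp
      finally show False using x(2) by simp
    qed
    then obtain k where k: "k < n" "y k \<noteq> 0" by blast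
    show ?thesis
    proof (rule sum_pos2[of _ k])
      show "0 < d k * (y k * y k)"
        using k d[of k] by (auto simp: zero_less_mult_iff)
    next
      show "0 \<le> d i * (y i * y i)" if "i \<in> {..<n}" for i
        using that d[of i] by simp
    qed (use k in auto)
  qed
  finally show ?thesis .
qed

text \<open>A vanishing minor yields a nonzero kernel vector of the submatrix. Extended by zero
  outside \<open>I\<close>, it is a nonzero vector at which the form is 0.\<close>

lemma pos_def_principal_minor_nonzero:
  fixes M :: "'a::{idom, linorder} mat"
  assumes M: "M \<in> carrier_mat n n" and I: "I \<subseteq> {0..<n}"
    and pd: "\<And>x i. i < n \<Longrightarrow> x i \<noteq> 0 \<Longrightarrow> (\<Sum>i<n. \<Sum>j<n. d i * x i * M $$ (i, j) * x j) > 0"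
  shows "det (submatrix M I I) \<noteq> 0"
proof
  assume "det (submatrix M I I) = 0"
  note S = principal_submatrix_carrier[OF M I]
  have fin: "finite I" using I finite_subset by blast
  note bij = bij_betw_pick[OF fin]
  from \<open>det _ = 0\<close> obtain v where v: "v \<in> carrier_vec (card I)" "v \<noteq> 0\<^sub>v (card I)"
    and Sv: "submatrix M I I *\<^sub>v v = 0\<^sub>v (card I)"
    using det_0_iff_vec_prod_zero[OF S] by blast
  \<comment> \<open>The inverse of \<open>pick I\<close> sends an element of \<open>I\<close> to its
    position in \<open>I\<close>, so \<open>x\<close> carries the coordinates of \<open>v\<close> on
    \<open>I\<close>.\<close>
  define x where "x i = (if i \<in> I then v $ (the_inv_into {..<card I} (pick I) i) else 0)" for i
  have xp: "x (pick I a) = v $ a" if "a < card I" for a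
    using that bij pick_in_set_le[OF that]
    by (auto simp: x_def bij_betw_def the_inv_into_f_f)
  obtain a where a: "a < card I" "v $ a \<noteq> 0"
    using v by (metis carrier_vecD eq_vecI index_zero_vec(1) index_zero_vec(2))
  have row: "(\<Sum>j<n. M $$ (pick I b, j) * x j) = 0" if b: "b < card I" for b
  proof -
    have "(\<Sum>j<n. M $$ (pick I b, j) * x j) = (\<Sum>j\<in>I. M $$ (pick I b, j) * x j)"
      using I by (intro sum.mono_neutral_right) (auto simp: x_def)
    also have "\<dots> = (\<Sum>c<card I. M $$ (pick I b, pick I c) * x (pick I c))"
      by (rule sum.reindex_bij_betw[OF bij, symmetric])
    also have "\<dots> = (submatrix M I I *\<^sub>v v) $ b"
      using b S v(1)
      by (auto simp: scalar_prod_def atLeast0LessThan principal_submatrix_index[OF M I] xp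
          intro!: sum.cong)
    finally show ?thesis using b by (simp add: Sv)
  qed
  \<comment> \<open>Row \<open>i\<close> contributes nothing: inside \<open>I\<close> because
    \<open>v\<close> is in the kernel, outside \<open>I\<close> because
    \<open>x i = 0\<close>.\<close>
  have "(\<Sum>j<n. d i * x i * M $$ (i, j) * x j) = 0" for i
  proof (cases "i \<in> I")
    case True
    then obtain b where "b < card I" "i = pick I b"
      using bij by (auto simp: bij_betw_def)
    thus ?thesis using row[of b] by (simp add: sum_distrib_left[symmetric] mult.assoc)
  qed (simp add: x_def)
  hence "(\<Sum>i<n. \<Sum>j<n. d i * x i * M $$ (i, j) * x j) = 0" by simp
  with pd[of "pick I a" x] a pick_less[OF I a(1)] show False by (simp add: xp)
qed

text \<open>By the Leibniz formula the minor is a fixed polynomial in entries of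
  \<open>exp (t A)\<close>, each of which is continuous in \<open>t\<close>.\<close>

lemma isCont_principal_minor_exp_mat:
  assumes A: "A \<in> carrier_mat n n" and I: "I \<subseteq> {0..<n}"
  shows "isCont (\<lambda>t. det (submatrix (exp_mat (t \<cdot>\<^sub>m A)) I I)) t"
proof -
  have E: "exp_mat (t \<cdot>\<^sub>m A) \<in> carrier_mat n n" for t using A by simp
  note S = principal_submatrix_carrier[OF E I]
  have "det (submatrix (exp_mat (t \<cdot>\<^sub>m A)) I I) =
      (\<Sum>p \<in> {p. p permutes {0..<card I}}. signof p *
        (\<Prod>a = 0..<card I. exp_mat (t \<cdot>\<^sub>m A) $$ (pick I a, pick I (p a))))" for t
  proof -
    have "submatrix (exp_mat (t \<cdot>\<^sub>m A)) I I $$ (a, p a) = exp_mat (t \<cdot>\<^sub>m A) $$ (pick I a, pick I (p a))"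
      if "p permutes {0..<card I}" "a \<in> {0..<card I}" for p a
      using that permutes_in_image[OF that(1), of a] by (intro principal_submatrix_index[OF E I]) auto
    thus ?thesis unfolding det_def'[OF S] by simp
  qed
  moreover have "isCont (\<lambda>t. exp_mat (t \<cdot>\<^sub>m A) $$ (pick I a, pick I (p a))) t"
    if "p permutes {0..<card I}" "a \<in> {0..<card I}" for p a
    using that permutes_in_image[OF that(1), of a]
    by (intro isCont_exp_mat_smult[OF A] pick_less[OF I]) auto
  ultimately show ?thesis by (auto intro!: continuous_intros)
qed

lemma symmetrizable_EP_matrix:
  assumes A: "A \<in> carrier_mat n n"
    and sym: "\<And>i j. i < n \<Longrightarrow> j < n \<Longrightarrow> d i * A $$ (i, j) = d j * A $$ (j, i)"
    and d: "\<And>i. i < n \<Longrightarrow> d i > 0"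
  shows "EP_matrix A"
proof -
  have "det (submatrix (exp_mat (t \<cdot>\<^sub>m A)) I I) > 0" if t: "t \<ge> 0" and I: "I \<subseteq> {0..<n}" for t I
  proof (rule ccontr)
    let ?f = "\<lambda>t. det (submatrix (exp_mat (t \<cdot>\<^sub>m A)) I I)"
    assume "\<not> ?f t > 0"
    moreover have "?f 0 = 1"
    proof -
      have "submatrix (1\<^sub>m n) I I = (1\<^sub>m (card I) :: real mat)"
      proof (rule eq_matI)
        fix a b assume "a < dim_row (1\<^sub>m (card I) :: real mat)" "b < dim_col (1\<^sub>m (card I) :: real mat)"
        hence ab: "a < card I" "b < card I" by auto
        have "pick I a = pick I b \<longleftrightarrow> a = b"
          using bij_betw_pick[OF finite_subset[OF I]] ab by (auto simp: bij_betw_def inj_on_def)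
        thus "submatrix (1\<^sub>m n) I I $$ (a, b) = (1\<^sub>m (card I) :: real mat) $$ (a, b)"
          using ab pick_less[OF I] by (simp add: principal_submatrix_index[of _ n, OF _ I])
      qed (use principal_submatrix_carrier[of "1\<^sub>m n :: real mat" n, OF _ I] in auto)
      thus ?thesis by (simp add: exp_mat_smult_zero[OF A])
    qed
    \<comment> \<open>A minor that is at most 0 at \<open>t\<close> and equal to 1 at 0 must vanish
      in between, which positive definiteness at \<open>s\<close> excludes.\<close>
    ultimately obtain s where "?f s = 0"
      using IVT2[of ?f t 0 0] t isCont_principal_minor_exp_mat[OF A I] by auto
    moreover have "?f s \<noteq> 0"
      using A by (intro pos_def_principal_minor_nonzero[OF _ I, where d = d]
          symmetrizable_exp_mat_pos_def[OF A sym d]) auto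
    ultimately show False by simp
  qed
  moreover have "dim_row (exp_mat (t \<cdot>\<^sub>m A)) = n" "square_mat (exp_mat (t \<cdot>\<^sub>m A))" for t
    using A by (auto simp: exp_mat_def)
  ultimately show ?thesis using A by (auto simp: EP_matrix_def P_matrix_def)
qed

text \<open>For a tridiagonal matrix only neighbouring indices constrain the weights, so these can
  be chosen one after the other along the chain of indices.\<close>

lemma Jacobi_matrix_symmetrizable:
  assumes A: "A \<in> carrier_mat n n" and J: "Jacobi_matrix A"
  obtains d :: "nat \<Rightarrow> real" where "\<And>i. i < n \<Longrightarrow> d i > 0"
    and "\<And>i j. i < n \<Longrightarrow> j < n \<Longrightarrow> d i * A $$ (i, j) = d j * A $$ (j, i)"
proof
  \<comment> \<open>The relation between \<open>i\<close> and \<open>Suc i\<close> prescribes the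
    ratio of consecutive weights. Starting from \<open>d 0 = 1\<close>, the empty product, they are
    the partial products of these ratios, which are positive for a Jacobi matrix.\<close>
  define d :: "nat \<Rightarrow> real" where "d i = (\<Prod>k<i. A $$ (k, Suc k) / A $$ (Suc k, k))" for i
  have pos: "A $$ (k, Suc k) > 0" "A $$ (Suc k, k) > 0" if "Suc k < n" for k
    using J A that by (auto simp: Jacobi_matrix_def)
  have tri: "A $$ (i, j) = 0" if "i < n" "j < n" "Suc i < j \<or> Suc j < i" for i j
    using J A that by (auto simp: Jacobi_matrix_def tridiagonal_def)
  have step: "d i * A $$ (i, Suc i) = d (Suc i) * A $$ (Suc i, i)" if "Suc i < n" for i
    using pos[OF that] by (simp add: d_def)
  show "d i > 0" if "i < n" for i
    unfolding d_def using that pos by (intro prod_pos) auto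
  show "d i * A $$ (i, j) = d j * A $$ (j, i)" if "i < n" "j < n" for i j
  proof -
    consider "i = j" | "j = Suc i" | "i = Suc j" | "Suc i < j \<or> Suc j < i" by linarith
    thus ?thesis using step[of i] step[of j] tri[of i j] tri[of j i] that by cases auto
  qed
qed

theorem theorem6:
  fixes A :: "real mat" and n :: nat
  assumes "A \<in> carrier_mat n n"
    and "(lower_triangular A \<or> upper_triangular A) \<or> symmetric_matrix A \<or> Jacobi_matrix A"
  shows "EP_matrix A"
proof -
  note A = assms(1)
  from assms(2) consider "lower_triangular A" | "upper_triangular A" | "symmetric_matrix A"
    | "Jacobi_matrix A" by blast
  thus ?thesis
  proof cases
    case 1
    hence "upper_triangular (transpose_mat A)"
      using A by (auto simp: lower_triangular_def upper_triangular_def)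
    hence "EP_matrix (transpose_mat A)"
      using A by (intro upper_triangular_EP_matrix[of _ n]) auto
    thus ?thesis
      using EP_matrix_transpose[of "transpose_mat A" n] A by simp
  next
    case 2
    with A show ?thesis by (rule upper_triangular_EP_matrix)
  next
    case 3
    hence "A $$ (i, j) = A $$ (j, i)" if "i < n" "j < n" for i j
      using A that by (metis carrier_matD index_transpose_mat(1) symmetric_matrix_def)
    \<comment> \<open>A symmetric matrix is self-adjoint for the standard inner product, so all
      weights are 1.\<close>
    with A show ?thesis by (intro symmetrizable_EP_matrix[of A n "\<lambda>_. 1"]) auto
  next
    case 4
    obtain d :: "nat \<Rightarrow> real" where "\<And>i. i < n \<Longrightarrow> d i > 0"
      and "\<And>i j. i < n \<Longrightarrow> j < n \<Longrightarrow> d i * A $$ (i, j) = d j * A $$ (j, i)"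
      using Jacobi_matrix_symmetrizable[OF A 4] by blast
    with A show ?thesis by (intro symmetrizable_EP_matrix[of A n d])
  qed
qed

end
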